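(* Let $\alpha: I\subset\mathbb{R}\to\mathbf{E}^4$ be a unit speed curve in Euclidean 4-space with curvatures $\kappa_1,\kappa_2,\kappa_3$, all nowhere zero on $I$. Fix antiderivatives on $I$: $\phi(s)=\int\kappa_3(s)\,ds$ of $\kappa_3$, $P(s)=\int\kappa_2(s)\sin\phi(s)\,ds$ of $\kappa_2\sin\phi$, and $Q(s)=\int\kappa_2(s)\cos\phi(s)\,ds$ of $\kappa_2\cos\phi$. Then $\alpha$ is a slant helix if and only if there exist an antiderivative $K=\int\kappa_1\,ds$ of $\kappa_1$ on $I$ and constants $A,B\in\mathbb{R}$ such that, for all $s\in I$, $$\frac{\kappa_1(s)}{\kappa_2(s)}K(s)=\bigl(A-P(s)\bigr)\sin\phi(s)-\bigl(B+Q(s)\bigr)\cos\phi(s).$$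
   Context: $\mathbf{E}^4$ is $\mathbb{R}^4$ with the standard scalar product $\langle\cdot,\cdot\rangle$, and $I\subset\mathbb{R}$ is an open interval. A curve $\alpha:I\to\mathbf{E}^4$, assumed smooth, is of unit speed if $\langle\alpha'(s),\alpha'(s)\rangle=1$ for all $s\in I$. Its Frenet frame $\{\mathbf{T},\mathbf{N},\mathbf{B}_1,\mathbf{B}_2\}$ (tangent $\mathbf{T}=\alpha'$, principal normal, first binormal and second binormal) is an orthonormal frame along $\alpha$ satisfying $$\mathbf{T}'=\kappa_1\mathbf{N},\quad \mathbf{N}'=-\kappa_1\mathbf{T}+\kappa_2\mathbf{B}_1,\quad \mathbf{B}_1'=-\kappa_2\mathbf{N}+\kappa_3\mathbf{B}_2,\quad \mathbf{B}_2'=-\kappa_3\mathbf{B}_1,$$ where $\kappa_1,\kappa_2,\kappa_3: I\to\mathbb{R}$ are the first, second and third curvatures. Standing assumption: $\kappa_i(s)\neq 0$ for all $s\in I$ and $i=1,2,3$. The curve $\alpha$ is called a slant helix if its unit principal normal $\mathbf{N}$ makes a constant angle $\theta$ with a fixed direction $U$, i.e. there is a constant vector $U$, which may be taken of unit length, with $\langle\mathbf{N}(s),U\rangle=\cos\theta$ constant in $s\in I$. A prime denotes the derivative with respect to $s$.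
   Formalization: The slant helix is required to have a constant angle θ ≠ π/2 with its axis; for θ = π/2 the claim fails, e.g. κ1 = sin s, κ2 = κ3 = 1 on (0, π), where N is orthogonal to a fixed direction but the equation has no solution. *)

theory Defs
  imports "HOL-Analysis.Analysis"
begin

definition smooth_curve_on :: "real set \<Rightarrow> (real \<Rightarrow> real ^ 4) \<Rightarrow> bool" where
  "smooth_curve_on I \<alpha> \<longleftrightarrow>
     (\<exists>D. (\<forall>s\<in>I. D 0 s = \<alpha> s) \<and>
          (\<forall>n. \<forall>s\<in>I. (D n has_vector_derivative D (Suc n) s) (at s)))"

definition antiderivative_on :: "real set \<Rightarrow> (real \<Rightarrow> real) \<Rightarrow> (real \<Rightarrow> real) \<Rightarrow> bool" where
  "antiderivative_on I f F \<longleftrightarrow> (\<forall>s\<in>I. (F has_real_derivative f s) (at s))"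

definition orthonormal4 :: "real ^ 4 \<Rightarrow> real ^ 4 \<Rightarrow> real ^ 4 \<Rightarrow> real ^ 4 \<Rightarrow> bool" where
  "orthonormal4 t n b1 b2 \<longleftrightarrow>
     t \<bullet> t = 1 \<and> n \<bullet> n = 1 \<and> b1 \<bullet> b1 = 1 \<and> b2 \<bullet> b2 = 1 \<and>
     t \<bullet> n = 0 \<and> t \<bullet> b1 = 0 \<and> t \<bullet> b2 = 0 \<and>
     n \<bullet> b1 = 0 \<and> n \<bullet> b2 = 0 \<and> b1 \<bullet> b2 = 0"

text \<open>The unit speed condition on \<open>\<alpha>\<close> is the equation \<open>T \<bullet> T = 1\<close> for
  the tangent \<open>T = \<alpha>'\<close>, contained in \<open>orthonormal4\<close>. All functions are total, but
  only their values on the open interval \<open>I\<close> matter.\<close>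

definition frenet_apparatus ::
  "real set \<Rightarrow> (real \<Rightarrow> real ^ 4) \<Rightarrow>
   (real \<Rightarrow> real ^ 4) \<Rightarrow> (real \<Rightarrow> real ^ 4) \<Rightarrow> (real \<Rightarrow> real ^ 4) \<Rightarrow> (real \<Rightarrow> real ^ 4) \<Rightarrow>
   (real \<Rightarrow> real) \<Rightarrow> (real \<Rightarrow> real) \<Rightarrow> (real \<Rightarrow> real) \<Rightarrow> bool" where
  "frenet_apparatus I \<alpha> T N B1 B2 \<kappa>1 \<kappa>2 \<kappa>3 \<longleftrightarrow>
     (\<forall>s\<in>I.
        (\<alpha> has_vector_derivative T s) (at s) \<and>
        orthonormal4 (T s) (N s) (B1 s) (B2 s) \<and>
        (T has_vector_derivative \<kappa>1 s *\<^sub>R N s) (at s) \<and>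
        (N has_vector_derivative - \<kappa>1 s *\<^sub>R T s + \<kappa>2 s *\<^sub>R B1 s) (at s) \<and>
        (B1 has_vector_derivative - \<kappa>2 s *\<^sub>R N s + \<kappa>3 s *\<^sub>R B2 s) (at s) \<and>
        (B2 has_vector_derivative - \<kappa>3 s *\<^sub>R B1 s) (at s))"

text \<open>A curve with principal normal \<open>N\<close> is a slant helix of angle \<open>\<theta>\<close> if \<open>N\<close> makes the
  constant angle \<open>\<theta>\<close> with a fixed direction \<open>U\<close>. The right angle \<open>\<theta> = pi / 2\<close> is allowed
  here, but has to be excluded in the characterization by \<open>(\<kappa>1 / \<kappa>2) K\<close>, which
  normalizes \<open>U\<close> by the factor \<open>1 / cos \<theta>\<close>: the curve with \<open>\<kappa>1 s = sin s\<close> and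
  \<open>\<kappa>2 = \<kappa>3 = 1\<close> on \<open>0 < s < pi\<close> has the fixed direction
  \<open>T + sin s B1 + cos s B2\<close>, orthogonal to \<open>N\<close>, but does not satisfy the integral equation.\<close>

definition slant_helix_of_angle :: "real set \<Rightarrow> (real \<Rightarrow> real ^ 4) \<Rightarrow> real \<Rightarrow> bool" where
  "slant_helix_of_angle I N \<theta> \<longleftrightarrow>
     0 \<le> \<theta> \<and> \<theta> \<le> pi \<and> (\<exists>U. norm U = 1 \<and> (\<forall>s\<in>I. N s \<bullet> U = cos \<theta>))"

end

theory Submission
  imports Defs
begin

text \<open>A slant helix of angle \<open>\<theta> \<noteq> pi / 2\<close> has an axis \<open>U\<close> that can be rescaled to
  \<open>W = U / cos \<theta>\<close>, so that \<open>N \<bullet> W = 1\<close>; conversely, normalizing any constant \<open>W\<close>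
  with \<open>N \<bullet> W = 1\<close> gives an axis. So the question is when such a constant \<open>W\<close> exists. In the
  Frenet frame write \<open>W = K T + N + x B1 + y B2\<close>. By the Frenet equations \<open>W\<close> is constant
  if and only if
  \<open>K' = \<kappa>1\<close>, \<open>\<kappa>1 K = \<kappa>2 x\<close>, \<open>x' = - \<kappa>2 + \<kappa>3 y\<close> and \<open>y' = - \<kappa>3 x\<close>.
  The first two equations say that \<open>K\<close> is an antiderivative of \<open>\<kappa>1\<close> and that
  \<open>x = (\<kappa>1 / \<kappa>2) K\<close>. The last two form a linear system for \<open>(x, y)\<close>; in coordinates
  rotated by the angle \<open>\<phi>\<close> it becomes \<open>u' = - \<kappa>2 sin \<phi>\<close>, \<open>v' = - \<kappa>2 cos \<phi>\<close>, which is solved by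
  quadrature: \<open>u = A - P\<close> and \<open>v = - (B + Q)\<close>. Rotating back, the formula for \<open>x\<close> is
  the right-hand side of the integral equation.\<close>

lemma constant_on_interval_of_zero_derivative:
  fixes f :: "real \<Rightarrow> 'a::real_normed_vector"
  assumes "is_interval I" and "\<And>s. s \<in> I \<Longrightarrow> (f has_vector_derivative 0) (at s)"
  obtains c where "\<And>s. s \<in> I \<Longrightarrow> f s = c"
proof (rule has_vector_derivative_zero_constant[of I f])
  show "convex I"
    using assms(1) by (rule is_interval_convex)
  show "(f has_vector_derivative 0) (at s within I)" if "s \<in> I" for s
    using assms(2)[OF that] by (rule has_vector_derivative_at_within)
qed (use that in blast)

lemma has_real_derivative_inner_const:
  fixes F :: "real \<Rightarrow> 'a::real_inner"
  assumes "(F has_vector_derivative F') (at s)"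
  shows "((\<lambda>s. F s \<bullet> W) has_real_derivative F' \<bullet> W) (at s)"
  using bounded_linear.has_vector_derivative[OF bounded_linear_inner_left assms, of W]
  by (simp add: has_real_derivative_iff_has_vector_derivative)

text \<open>The rotation by \<open>\<phi>\<close> is chosen to cancel the homogeneous part of the system: the
  derivative of the rotation, \<open>\<kappa>3\<close>, is the coefficient that couples \<open>x\<close> and \<open>y\<close>.\<close>

lemma coupled_system_solution:
  fixes x y k \<kappa> \<phi> P Q :: "real \<Rightarrow> real"
  assumes I: "is_interval I"
    and \<phi>: "antiderivative_on I \<kappa> \<phi>"
    and P: "antiderivative_on I (\<lambda>s. k s * sin (\<phi> s)) P"
    and Q: "antiderivative_on I (\<lambda>s. k s * cos (\<phi> s)) Q"
    and x: "\<And>s. s \<in> I \<Longrightarrow> (x has_real_derivative - k s + \<kappa> s * y s) (at s)"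
    and y: "\<And>s. s \<in> I \<Longrightarrow> (y has_real_derivative - \<kappa> s * x s) (at s)"
  obtains A B where
    "\<And>s. s \<in> I \<Longrightarrow> x s = (A - P s) * sin (\<phi> s) - (B + Q s) * cos (\<phi> s)"
proof -
  have "((\<lambda>s. x s * sin (\<phi> s) + y s * cos (\<phi> s) + P s) has_vector_derivative 0) (at s)"
    if s: "s \<in> I" for s
    using \<phi> P s unfolding antiderivative_on_def has_real_derivative_iff_has_vector_derivative[symmetric]
    by (auto intro!: derivative_eq_intros x[OF s] y[OF s] simp: algebra_simps)
  then obtain A where A: "\<And>s. s \<in> I \<Longrightarrow> x s * sin (\<phi> s) + y s * cos (\<phi> s) + P s = A"
    using constant_on_interval_of_zero_derivative[OF I] by blast
  have "((\<lambda>s. x s * cos (\<phi> s) - y s * sin (\<phi> s) + Q s) has_vector_derivative 0) (at s)"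
    if s: "s \<in> I" for s
    using \<phi> Q s unfolding antiderivative_on_def has_real_derivative_iff_has_vector_derivative[symmetric]
    by (auto intro!: derivative_eq_intros x[OF s] y[OF s] simp: algebra_simps)
  then obtain C where C: "\<And>s. s \<in> I \<Longrightarrow> x s * cos (\<phi> s) - y s * sin (\<phi> s) + Q s = C"
    using constant_on_interval_of_zero_derivative[OF I] by blast
  have "x s = (A - P s) * sin (\<phi> s) - (- C + Q s) * cos (\<phi> s)" if s: "s \<in> I" for s
  proof -
    have u: "A - P s = x s * sin (\<phi> s) + y s * cos (\<phi> s)"
      and v: "- C + Q s = y s * sin (\<phi> s) - x s * cos (\<phi> s)"
      using A[OF s] C[OF s] by linarith+
    have "(A - P s) * sin (\<phi> s) - (- C + Q s) * cos (\<phi> s)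
        = x s * ((sin (\<phi> s))\<^sup>2 + (cos (\<phi> s))\<^sup>2)"
      unfolding u v by algebra
    then show ?thesis by simp
  qed
  then show thesis by (rule that)
qed

text \<open>All four coordinate equations of \<open>W' = 0\<close> can be read off from \<open>N \<bullet> W = 1\<close>: the
  derivatives of the products of \<open>T\<close>, \<open>B1\<close> and \<open>B2\<close> with \<open>W\<close> give three of them, the
  vanishing derivative of \<open>N \<bullet> W\<close> is the algebraic one.\<close>

lemma integral_equation_of_normal_product_one:
  fixes W :: "real ^ 4"
  assumes "open I" and I: "is_interval I"
    and F: "frenet_apparatus I \<alpha> T N B1 B2 \<kappa>1 \<kappa>2 \<kappa>3"
    and \<kappa>2: "\<And>s. s \<in> I \<Longrightarrow> \<kappa>2 s \<noteq> 0"
    and \<phi>: "antiderivative_on I \<kappa>3 \<phi>"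
    and P: "antiderivative_on I (\<lambda>s. \<kappa>2 s * sin (\<phi> s)) P"
    and Q: "antiderivative_on I (\<lambda>s. \<kappa>2 s * cos (\<phi> s)) Q"
    and NW: "\<And>s. s \<in> I \<Longrightarrow> N s \<bullet> W = 1"
  shows "\<exists>K A B. antiderivative_on I \<kappa>1 K \<and>
     (\<forall>s\<in>I. \<kappa>1 s / \<kappa>2 s * K s = (A - P s) * sin (\<phi> s) - (B + Q s) * cos (\<phi> s))"
proof -
  have T': "((\<lambda>s. T s \<bullet> W) has_real_derivative \<kappa>1 s) (at s)"
    and B1': "((\<lambda>s. B1 s \<bullet> W) has_real_derivative - \<kappa>2 s + \<kappa>3 s * (B2 s \<bullet> W)) (at s)"
    and B2': "((\<lambda>s. B2 s \<bullet> W) has_real_derivative - \<kappa>3 s * (B1 s \<bullet> W)) (at s)"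
    and N': "((\<lambda>s. N s \<bullet> W) has_real_derivative
                - \<kappa>1 s * (T s \<bullet> W) + \<kappa>2 s * (B1 s \<bullet> W)) (at s)"
    if s: "s \<in> I" for s
  proof -
    have T: "(T has_vector_derivative \<kappa>1 s *\<^sub>R N s) (at s)"
      and N: "(N has_vector_derivative - \<kappa>1 s *\<^sub>R T s + \<kappa>2 s *\<^sub>R B1 s) (at s)"
      and B1: "(B1 has_vector_derivative - \<kappa>2 s *\<^sub>R N s + \<kappa>3 s *\<^sub>R B2 s) (at s)"
      and B2: "(B2 has_vector_derivative - \<kappa>3 s *\<^sub>R B1 s) (at s)"
      using F s unfolding frenet_apparatus_def by blast+
    show "((\<lambda>s. T s \<bullet> W) has_real_derivative \<kappa>1 s) (at s)"
      using has_real_derivative_inner_const[OF T, of W] NW[OF s] by simp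
    show "((\<lambda>s. B1 s \<bullet> W) has_real_derivative - \<kappa>2 s + \<kappa>3 s * (B2 s \<bullet> W)) (at s)"
      using has_real_derivative_inner_const[OF B1, of W] NW[OF s] by (simp add: inner_diff_left)
    show "((\<lambda>s. B2 s \<bullet> W) has_real_derivative - \<kappa>3 s * (B1 s \<bullet> W)) (at s)"
      using has_real_derivative_inner_const[OF B2, of W] by simp
    show "((\<lambda>s. N s \<bullet> W) has_real_derivative
             - \<kappa>1 s * (T s \<bullet> W) + \<kappa>2 s * (B1 s \<bullet> W)) (at s)"
      using has_real_derivative_inner_const[OF N, of W] by (simp add: inner_diff_left)
  qed
  have B1_eq: "\<kappa>1 s / \<kappa>2 s * (T s \<bullet> W) = B1 s \<bullet> W" if s: "s \<in> I" for s
  proof -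
    have "((\<lambda>s. N s \<bullet> W) has_real_derivative 0) (at s)"
      by (rule has_field_derivative_transform_within_open
            [OF DERIV_const[of 1] \<open>open I\<close> s]) (simp add: NW)
    then have "- \<kappa>1 s * (T s \<bullet> W) + \<kappa>2 s * (B1 s \<bullet> W) = 0"
      using N'[OF s] DERIV_unique by blast
    then show ?thesis
      using \<kappa>2[OF s] by (simp add: field_simps)
  qed
  obtain A B where
    "\<And>s. s \<in> I \<Longrightarrow> B1 s \<bullet> W = (A - P s) * sin (\<phi> s) - (B + Q s) * cos (\<phi> s)"
    using coupled_system_solution[OF I \<phi> P Q B1' B2'] by blast
  with B1_eq T' show ?thesis
    unfolding antiderivative_on_def by (intro exI[of _ "\<lambda>s. T s \<bullet> W"]) auto
qed

text \<open>The second binormal coordinate \<open>y\<close> of \<open>W\<close> does not occur in the integral equation. It is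
  recovered as the other component of the same rotated vector \<open>(A - P, - (B + Q))\<close>.\<close>

lemma normal_product_one_of_integral_equation:
  assumes I: "is_interval I"
    and F: "frenet_apparatus I \<alpha> T N B1 B2 \<kappa>1 \<kappa>2 \<kappa>3"
    and \<kappa>2: "\<And>s. s \<in> I \<Longrightarrow> \<kappa>2 s \<noteq> 0"
    and \<phi>: "antiderivative_on I \<kappa>3 \<phi>"
    and P: "antiderivative_on I (\<lambda>s. \<kappa>2 s * sin (\<phi> s)) P"
    and Q: "antiderivative_on I (\<lambda>s. \<kappa>2 s * cos (\<phi> s)) Q"
    and K: "antiderivative_on I \<kappa>1 K"
    and eq: "\<And>s. s \<in> I \<Longrightarrow>
      \<kappa>1 s / \<kappa>2 s * K s = (A - P s) * sin (\<phi> s) - (B + Q s) * cos (\<phi> s)"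
  obtains W where "\<And>s. s \<in> I \<Longrightarrow> N s \<bullet> W = 1"
proof -
  define x where "x s = (A - P s) * sin (\<phi> s) - (B + Q s) * cos (\<phi> s)" for s
  define y where "y s = (A - P s) * cos (\<phi> s) + (B + Q s) * sin (\<phi> s)" for s
  define w where "w s = K s *\<^sub>R T s + N s + x s *\<^sub>R B1 s + y s *\<^sub>R B2 s" for s
  have w': "(w has_vector_derivative 0) (at s)" if s: "s \<in> I" for s
  proof -
    have d\<phi>: "(\<phi> has_real_derivative \<kappa>3 s) (at s)"
      and dP: "(P has_real_derivative \<kappa>2 s * sin (\<phi> s)) (at s)"
      and dQ: "(Q has_real_derivative \<kappa>2 s * cos (\<phi> s)) (at s)"
      and dK: "(K has_real_derivative \<kappa>1 s) (at s)"
      using \<phi> P Q K s unfolding antiderivative_on_def by blast+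
    have trig: "\<kappa>2 s * (sin (\<phi> s))\<^sup>2 + \<kappa>2 s * (cos (\<phi> s))\<^sup>2 = \<kappa>2 s"
      by (simp flip: distrib_left)
    have dx: "(x has_real_derivative - \<kappa>2 s + \<kappa>3 s * y s) (at s)"
      unfolding x_def y_def using trig
      by (auto intro!: derivative_eq_intros d\<phi> dP dQ simp: algebra_simps power2_eq_square)
    have dy: "(y has_real_derivative - \<kappa>3 s * x s) (at s)"
      unfolding x_def y_def
      by (auto intro!: derivative_eq_intros d\<phi> dP dQ simp: algebra_simps)
    have T: "(T has_vector_derivative \<kappa>1 s *\<^sub>R N s) (at s)"
      and N: "(N has_vector_derivative - \<kappa>1 s *\<^sub>R T s + \<kappa>2 s *\<^sub>R B1 s) (at s)"
      and B1: "(B1 has_vector_derivative - \<kappa>2 s *\<^sub>R N s + \<kappa>3 s *\<^sub>R B2 s) (at s)"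
      and B2: "(B2 has_vector_derivative - \<kappa>3 s *\<^sub>R B1 s) (at s)"
      using F s unfolding frenet_apparatus_def by blast+
    have normal: "\<kappa>1 s * K s = \<kappa>2 s * x s"
      using eq[OF s] \<kappa>2[OF s] by (simp add: x_def field_simps)
    have "(w has_vector_derivative
            (K s *\<^sub>R (\<kappa>1 s *\<^sub>R N s) + \<kappa>1 s *\<^sub>R T s)
            + (- \<kappa>1 s *\<^sub>R T s + \<kappa>2 s *\<^sub>R B1 s)
            + (x s *\<^sub>R (- \<kappa>2 s *\<^sub>R N s + \<kappa>3 s *\<^sub>R B2 s) + (- \<kappa>2 s + \<kappa>3 s * y s) *\<^sub>R B1 s)
            + (y s *\<^sub>R (- \<kappa>3 s *\<^sub>R B1 s) + (- \<kappa>3 s * x s) *\<^sub>R B2 s)) (at s)"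
      unfolding w_def
      by (intro has_vector_derivative_add has_vector_derivative_scaleR dK dx dy T N B1 B2)
    also have "(K s *\<^sub>R (\<kappa>1 s *\<^sub>R N s) + \<kappa>1 s *\<^sub>R T s)
            + (- \<kappa>1 s *\<^sub>R T s + \<kappa>2 s *\<^sub>R B1 s)
            + (x s *\<^sub>R (- \<kappa>2 s *\<^sub>R N s + \<kappa>3 s *\<^sub>R B2 s) + (- \<kappa>2 s + \<kappa>3 s * y s) *\<^sub>R B1 s)
            + (y s *\<^sub>R (- \<kappa>3 s *\<^sub>R B1 s) + (- \<kappa>3 s * x s) *\<^sub>R B2 s)
          = (\<kappa>1 s * K s - \<kappa>2 s * x s) *\<^sub>R N s"
      by (simp add: algebra_simps)
    finally show ?thesis
      using normal by simp
  qed
  obtain W where W: "\<And>s. s \<in> I \<Longrightarrow> w s = W"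
    using constant_on_interval_of_zero_derivative[OF I w'] by blast
  have "N s \<bullet> W = 1" if s: "s \<in> I" for s
  proof -
    have "orthonormal4 (T s) (N s) (B1 s) (B2 s)"
      using F s unfolding frenet_apparatus_def by blast
    then have "N s \<bullet> w s = 1"
      by (simp add: w_def orthonormal4_def inner_add_right inner_commute)
    then show ?thesis
      using W[OF s] by simp
  qed
  then show thesis by (rule that)
qed

text \<open>The correspondence between unit axes \<open>U\<close> and rescaled axes \<open>W\<close> is \<open>W = U / cos \<theta>\<close>
  in one direction and \<open>U = W / norm W\<close> in the other. A point of \<open>I\<close> is what makes \<open>W\<close>
  nonzero. The angle \<open>arccos (1 / norm W)\<close> exists by
  the Cauchy-Schwarz inequality \<open>1 = N \<bullet> W \<le> norm W\<close>, and it is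
  less than \<open>pi / 2\<close> because its cosine is positive.\<close>

lemma slant_helix_iff_normal_product_one:
  assumes ne: "I \<noteq> {}" and unit: "\<And>s. s \<in> I \<Longrightarrow> norm (N s) = 1"
  shows "(\<exists>\<theta>. \<theta> \<noteq> pi / 2 \<and> slant_helix_of_angle I N \<theta>) \<longleftrightarrow> (\<exists>W. \<forall>s\<in>I. N s \<bullet> W = 1)"
proof
  assume "\<exists>\<theta>. \<theta> \<noteq> pi / 2 \<and> slant_helix_of_angle I N \<theta>"
  then obtain \<theta> U where \<theta>: "\<theta> \<noteq> pi / 2" "0 \<le> \<theta>" "\<theta> \<le> pi"
    and U: "\<And>s. s \<in> I \<Longrightarrow> N s \<bullet> U = cos \<theta>"
    unfolding slant_helix_of_angle_def by blast
  have "cos \<theta> \<noteq> 0"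
    using \<theta> arccos_cos[of \<theta>] by (metis arccos_0)
  with U show "\<exists>W. \<forall>s\<in>I. N s \<bullet> W = 1"
    by (intro exI[of _ "(1 / cos \<theta>) *\<^sub>R U"]) simp
next
  assume "\<exists>W. \<forall>s\<in>I. N s \<bullet> W = 1"
  then obtain W where W: "\<And>s. s \<in> I \<Longrightarrow> N s \<bullet> W = 1" by blast
  from ne obtain s0 where s0: "s0 \<in> I" by blast
  have W1: "1 \<le> norm W"
    using norm_cauchy_schwarz[of "N s0" W] W[OF s0] unit[OF s0] by simp
  then have pos: "0 < norm W" by linarith
  define \<theta> where "\<theta> = arccos (1 / norm W)"
  have bounds: "0 < 1 / norm W" "1 / norm W \<le> 1"
    using W1 pos by auto
  then have "- 1 \<le> 1 / norm W" by linarith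
  with bounds have cos: "cos \<theta> = 1 / norm W" and range: "0 \<le> \<theta>" "\<theta> \<le> pi"
    unfolding \<theta>_def by (simp_all only: cos_arccos arccos_lbound arccos_ubound)
  have "\<theta> \<noteq> pi / 2"
    using cos bounds(1) cos_pi_half by force
  moreover have "slant_helix_of_angle I N \<theta>"
    unfolding slant_helix_of_angle_def using range cos pos W
    by (auto intro!: exI[of _ "(1 / norm W) *\<^sub>R W"])
  ultimately show "\<exists>\<theta>. \<theta> \<noteq> pi / 2 \<and> slant_helix_of_angle I N \<theta>" by blast
qed

theorem theorem3p2:
  fixes I :: "real set"
    and \<alpha> T N B1 B2 :: "real \<Rightarrow> real ^ 4"
    and \<kappa>1 \<kappa>2 \<kappa>3 \<phi> P Q :: "real \<Rightarrow> real"
  assumes "open I" and "is_interval I" and "I \<noteq> {}"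
    and "smooth_curve_on I \<alpha>"
    and "frenet_apparatus I \<alpha> T N B1 B2 \<kappa>1 \<kappa>2 \<kappa>3"
    and "\<forall>s\<in>I. \<kappa>1 s \<noteq> 0 \<and> \<kappa>2 s \<noteq> 0 \<and> \<kappa>3 s \<noteq> 0"
    and "antiderivative_on I \<kappa>3 \<phi>"
    and "antiderivative_on I (\<lambda>s. \<kappa>2 s * sin (\<phi> s)) P"
    and "antiderivative_on I (\<lambda>s. \<kappa>2 s * cos (\<phi> s)) Q"
  shows "(\<exists>\<theta>. \<theta> \<noteq> pi / 2 \<and> slant_helix_of_angle I N \<theta>) \<longleftrightarrow>
         (\<exists>K A B. antiderivative_on I \<kappa>1 K \<and>
            (\<forall>s\<in>I. \<kappa>1 s / \<kappa>2 s * K s =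
                     (A - P s) * sin (\<phi> s) - (B + Q s) * cos (\<phi> s)))"
proof -
  have unit: "norm (N s) = 1" if "s \<in> I" for s
    using assms(5) that unfolding frenet_apparatus_def orthonormal4_def norm_eq_1 by blast
  have \<kappa>2: "\<kappa>2 s \<noteq> 0" if "s \<in> I" for s
    using assms(6) that by blast
  have "(\<exists>\<theta>. \<theta> \<noteq> pi / 2 \<and> slant_helix_of_angle I N \<theta>) \<longleftrightarrow> (\<exists>W. \<forall>s\<in>I. N s \<bullet> W = 1)"
    using assms(3) unit by (rule slant_helix_iff_normal_product_one)
  also have "\<dots> \<longleftrightarrow> (\<exists>K A B. antiderivative_on I \<kappa>1 K \<and>
        (\<forall>s\<in>I. \<kappa>1 s / \<kappa>2 s * K s = (A - P s) * sin (\<phi> s) - (B + Q s) * cos (\<phi> s)))"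
  proof
    assume "\<exists>W. \<forall>s\<in>I. N s \<bullet> W = 1"
    then obtain W where "\<And>s. s \<in> I \<Longrightarrow> N s \<bullet> W = 1" by blast
    then show "\<exists>K A B. antiderivative_on I \<kappa>1 K \<and>
        (\<forall>s\<in>I. \<kappa>1 s / \<kappa>2 s * K s = (A - P s) * sin (\<phi> s) - (B + Q s) * cos (\<phi> s))"
      using integral_equation_of_normal_product_one[OF assms(1,2,5) \<kappa>2 assms(7-9), of W] by blast
  next
    assume "\<exists>K A B. antiderivative_on I \<kappa>1 K \<and>
        (\<forall>s\<in>I. \<kappa>1 s / \<kappa>2 s * K s = (A - P s) * sin (\<phi> s) - (B + Q s) * cos (\<phi> s))"
    then obtain K A B where "antiderivative_on I \<kappa>1 K"
      and "\<And>s. s \<in> I \<Longrightarrow>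
        \<kappa>1 s / \<kappa>2 s * K s = (A - P s) * sin (\<phi> s) - (B + Q s) * cos (\<phi> s)" by blast
    then show "\<exists>W. \<forall>s\<in>I. N s \<bullet> W = 1"
      using normal_product_one_of_integral_equation[OF assms(2,5) \<kappa>2 assms(7-9), of K A B] by metis
  qed
  finally show ?thesis .
qed

end
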